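(* Let $p\in(0,1)$ be a constant, let $\mathbf G_n\sim G(n,p)$, and let $H$ be a fixed graph. (i) The number $X_H$ of subgraphs of $\mathbf G_n$ isomorphic to $H$ is concentrated around $$\mathbb E X_H=\frac1{\mathrm{aut}(H)}(n)_{|V(H)|}\,p^{|E(H)|},$$ where $\mathrm{aut}(H)$ is the number of automorphisms of $H$. (ii) For every set of roots $R=\{v_1,\dots,v_r\}\subset V(H)$ with no edges of $H$ between the roots, the random variable $\max_U X_{R,H}(U)$, where the maximum is over all $U=(u_1,\dots,u_r)$ with distinct $u_1,\dots,u_r\in[n]$, is concentrated around $$\mathbb E\max_U X_{R,H}(U)=\left(\frac1{\mathrm{aut}(H[R])}+o(1)\right)n^{|V(H)|-r}\,p^{|E(H)|},$$ where $\mathrm{aut}(H[R])$ is the number of automorphisms of $H$ that fix every root $v_1,\dots,v_r$.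
   Context: $G(n,p)$ is the random graph on vertex set $[n]=\{1,\dots,n\}$ in which each pair of distinct vertices is an edge independently with probability $p$. Graphs are finite, undirected, without loops; $(n)_k=n!/(n-k)!$. A sequence of random variables $X_n$ is concentrated around its mean $\mathbb EX_n$ if $\mathbb E|X_n/\mathbb EX_n-1|^q\to0$ as $n\to\infty$ for every $q>0$. For roots $R=\{v_1,\dots,v_r\}\subset V(H)$ and distinct $u_1,\dots,u_r\in[n]$, $X_{R,H}(U)$ is the number of (not necessarily induced) subgraphs $H'\subset\mathbf G_n$ with $u_1,\dots,u_r\in V(H')$ for which there is an isomorphism $f:V(H)\to V(H')$ of the graphs $H$ and $H'$ with $f(v_i)=u_i$ for all $i\in[r]$. *)

theory Defs
  imports "HOL-Probability.Probability" "HOL-Combinatorics.Permutations"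
begin

datatype 'a graph = Graph (verts: "'a set") (edges: "'a set set")

definition fin_graph :: "'a graph \<Rightarrow> bool" where
  "fin_graph H \<longleftrightarrow> finite (verts H) \<and> (\<forall>e\<in>edges H. e \<subseteq> verts H \<and> card e = 2)"

definition subgraph :: "'a graph \<Rightarrow> 'a graph \<Rightarrow> bool" where
  "subgraph H G \<longleftrightarrow> fin_graph H \<and> verts H \<subseteq> verts G \<and> edges H \<subseteq> edges G"

definition graph_iso :: "('a \<Rightarrow> 'b) \<Rightarrow> 'a graph \<Rightarrow> 'b graph \<Rightarrow> bool" where
  "graph_iso f H H' \<longleftrightarrow> bij_betw f (verts H) (verts H') \<and>
     (\<forall>x\<in>verts H. \<forall>y\<in>verts H. {x, y} \<in> edges H \<longleftrightarrow> {f x, f y} \<in> edges H')"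

text \<open>Requiring an automorphism to be the identity outside the vertex set
  (\<^const>\<open>permutes\<close>) makes each automorphism count exactly once.\<close>

definition automorphisms :: "'a graph \<Rightarrow> ('a \<Rightarrow> 'a) set" where
  "automorphisms H = {f. f permutes verts H \<and> graph_iso f H H}"

definition aut :: "'a graph \<Rightarrow> nat" where
  "aut H = card (automorphisms H)"

definition aut_rooted :: "'a list \<Rightarrow> 'a graph \<Rightarrow> nat" where
  "aut_rooted vs H = card {f \<in> automorphisms H. \<forall>v\<in>set vs. f v = v}"

definition vertex_pairs :: "nat \<Rightarrow> nat set set" where
  "vertex_pairs n = {e. e \<subseteq> {1..n} \<and> card e = 2}"

definition gnp :: "nat \<Rightarrow> real \<Rightarrow> nat graph pmf" where
  "gnp n p = map_pmf (\<lambda>\<omega>. Graph {1..n} {e \<in> vertex_pairs n. \<omega> e})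
     (Pi_pmf (vertex_pairs n) False (\<lambda>_. bernoulli_pmf p))"

definition subgraph_count :: "'a graph \<Rightarrow> 'b graph \<Rightarrow> nat" where
  "subgraph_count H G = card {H'. subgraph H' G \<and> (\<exists>f. graph_iso f H H')}"

text \<open>The roots \<open>v\<^sub>1, \<dots>, v\<^sub>r\<close> and their images \<open>u\<^sub>1, \<dots>, u\<^sub>r\<close>
  are lists of the same length.\<close>

definition rooted_count :: "'a list \<Rightarrow> 'a graph \<Rightarrow> 'b list \<Rightarrow> 'b graph \<Rightarrow> nat" where
  "rooted_count vs H us G = card {H'. subgraph H' G \<and> set us \<subseteq> verts H' \<and>
     (\<exists>f. graph_iso f H H' \<and> (\<forall>i<length vs. f (vs ! i) = us ! i))}"

definition root_tuples :: "nat \<Rightarrow> nat \<Rightarrow> nat list set" where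
  "root_tuples n r = {us. length us = r \<and> distinct us \<and> set us \<subseteq> {1..n}}"

text \<open>For \<open>n < r\<close> there are no admissible tuples and the value is the unspecified
  \<open>Max {}\<close>; only large \<open>n\<close> matter in asymptotic statements.\<close>

definition max_rooted_count :: "nat \<Rightarrow> 'a list \<Rightarrow> 'a graph \<Rightarrow> nat graph \<Rightarrow> nat" where
  "max_rooted_count n vs H G =
     Max ((\<lambda>us. rooted_count vs H us G) ` root_tuples n (length vs))"

text \<open>Integrability is required explicitly because the Bochner integral of a
  non-integrable function is \<open>0\<close>.\<close>

definition concentrated_around_mean :: "(nat \<Rightarrow> 'a pmf) \<Rightarrow> (nat \<Rightarrow> 'a \<Rightarrow> real) \<Rightarrow> bool" where
  "concentrated_around_mean M X \<longleftrightarrow>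
     (\<forall>n. integrable (measure_pmf (M n)) (X n)) \<and>
     (\<forall>q::real. q > 0 \<longrightarrow>
        (\<forall>n. integrable (measure_pmf (M n))
           (\<lambda>\<omega>. \<bar>X n \<omega> / measure_pmf.expectation (M n) (X n) - 1\<bar> powr q)) \<and>
        (\<lambda>n. measure_pmf.expectation (M n)
           (\<lambda>\<omega>. \<bar>X n \<omega> / measure_pmf.expectation (M n) (X n) - 1\<bar> powr q)) \<longlonglongrightarrow> 0)"

text \<open>As a truncated product on \<^typ>\<open>nat\<close>, this is \<open>0\<close> for \<open>k > n\<close>.\<close>

definition falling_fact :: "nat \<Rightarrow> nat \<Rightarrow> nat" where
  "falling_fact n k = (\<Prod>i<k. n - i)"

lemma falling_fact_eq: "k \<le> n \<Longrightarrow> real (falling_fact n k) = fact n / fact (n - k)"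
proof (induction k)
  case 0
  show ?case by (simp add: falling_fact_def)
next
  case (Suc k)
  have "n - k = Suc (n - Suc k)" using Suc.prems by simp
  then have "(fact (n - k) :: real) = real (n - k) * fact (n - Suc k)"
    by (metis fact_Suc)
  moreover have "real (falling_fact n (Suc k)) = real (falling_fact n k) * real (n - k)"
    by (simp add: falling_fact_def)
  ultimately show ?case using Suc by simp
qed

end

theory Submission
  imports Defs "HOL-Real_Asymp.Real_Asymp"
begin

text \<open>By Hoeffding's inequality and a union bound, with high probability every set of
  \<open>j \<le> |V(H)|\<close> vertices has \<open>n p\<^sup>j \<plusminus> \<delta> n\<close> common neighbours. In such a graph embeddings of
  \<open>H\<close> can be counted deterministically by placing the non-root vertices one at a time, uniformly
  in the images of the roots, so the maximum over the roots costs nothing. As the counts are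
  bounded by \<open>n\<close> to the power \<open>|V(H)| - r\<close>, convergence in probability of the normalised
  maximum gives convergence of its mean and of all moments. Part (i) is the case of no roots.\<close>

section \<open>Embeddings and copies\<close>

text \<open>The maximising root tuple depends on the graph, and there are about n^r tuples, so a
  bound for one fixed tuple would need tails strong enough for a union bound over tuples. Here
  randomness enters only through sets of at most |V(H)| vertices: there are polynomially many, each
  failing with exponentially small probability, and everything about roots is then deterministic.
  Having no edges of H between roots is essential: roots are placed at prescribed vertices, and
  whether these are adjacent is not controlled by any count of common neighbours. Injective
  edge-preserving maps are counted instead of copies because they can be built one vertex at a time;
  the symmetry factor is divided out afterwards. The exact mean in (i) does not follow from this
  asymptotic argument and is a separate use of linearity of expectation. In (ii) the mean of the
  maximum is never computed directly; its leading term is read off from the limit in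
  probability.\<close>

definition embeddings :: "'a list \<Rightarrow> 'a graph \<Rightarrow> 'b list \<Rightarrow> 'b graph \<Rightarrow> ('a \<Rightarrow> 'b) set" where
  "embeddings vs H us G = {f \<in> verts H \<rightarrow>\<^sub>E verts G. inj_on f (verts H) \<and>
     (\<forall>i<length vs. f (vs ! i) = us ! i) \<and> (\<forall>e\<in>edges H. f ` e \<in> edges G)}"

definition image_graph :: "('a \<Rightarrow> 'b) \<Rightarrow> 'a graph \<Rightarrow> 'b graph" where
  "image_graph f H = Graph (f ` verts H) ((`) f ` edges H)"

section \<open>Isomorphisms and image graphs\<close>

lemma fin_graph_edgeE:
  assumes "fin_graph H" "e \<in> edges H"
  obtains x y where "e = {x, y}" "x \<noteq> y" "x \<in> verts H" "y \<in> verts H"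
proof -
  from assms have "e \<subseteq> verts H" "card e = 2" by (auto simp: fin_graph_def)
  then show thesis using that by (auto simp: card_2_iff)
qed

lemma finite_edges:
  assumes "fin_graph H"
  shows "finite (edges H)"
  by (rule finite_subset[of _ "Pow (verts H)"]) (use assms in \<open>auto simp: fin_graph_def\<close>)

lemma fin_graph_induced:
  assumes "fin_graph (Graph V E)" "W \<subseteq> V"
  shows "fin_graph (Graph W {e \<in> E. e \<subseteq> W})"
  using assms by (auto simp: fin_graph_def intro: finite_subset)

lemma graph_iso_comp:
  assumes "graph_iso f H H'" "graph_iso g H' H''"
  shows "graph_iso (g \<circ> f) H H''"
  using assms unfolding graph_iso_def
  by (auto intro: bij_betw_trans dest: bij_betwE)

lemma graph_iso_inv_into:
  assumes "graph_iso f H H'"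
  shows "graph_iso (inv_into (verts H) f) H' H"
proof -
  have b: "bij_betw f (verts H) (verts H')" using assms by (simp add: graph_iso_def)
  show ?thesis unfolding graph_iso_def
  proof (intro conjI ballI)
    show "bij_betw (inv_into (verts H) f) (verts H') (verts H)"
      by (rule bij_betw_inv_into[OF b])
    have inv: "inv_into (verts H) f x \<in> verts H" "f (inv_into (verts H) f x) = x"
      if "x \<in> verts H'" for x
      using b that by (auto simp: bij_betw_def intro: inv_into_into f_inv_into_f)
    fix x y assume xy: "x \<in> verts H'" "y \<in> verts H'"
    have "{inv_into (verts H) f x, inv_into (verts H) f y} \<in> edges H \<longleftrightarrow>
        {f (inv_into (verts H) f x), f (inv_into (verts H) f y)} \<in> edges H'"
      using assms inv(1)[OF xy(1)] inv(1)[OF xy(2)] unfolding graph_iso_def by blast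
    then show "{x, y} \<in> edges H' \<longleftrightarrow> {inv_into (verts H) f x, inv_into (verts H) f y} \<in> edges H"
      by (simp only: inv(2)[OF xy(1)] inv(2)[OF xy(2)])
  qed
qed

lemma graph_iso_cong:
  assumes "\<And>x. x \<in> verts H \<Longrightarrow> f x = g x"
  shows "graph_iso f H H' \<longleftrightarrow> graph_iso g H H'"
  using assms unfolding graph_iso_def by (simp cong: bij_betw_cong)

lemma fin_graph_image_graph:
  assumes "fin_graph H" "inj_on f (verts H)"
  shows "fin_graph (image_graph f H)"
  using assms unfolding fin_graph_def image_graph_def
  by (auto simp: card_image inj_on_subset)

text \<open>Only reflection of edges needs care: a pair could become an edge of the image because
  some other edge has the same image. Injectivity on the vertex set excludes such
  collisions.\<close>

lemma graph_iso_image_graph: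
  assumes "fin_graph H" "inj_on f (verts H)"
  shows "graph_iso f H (image_graph f H)"
  unfolding graph_iso_def
proof (intro conjI ballI)
  show "bij_betw f (verts H) (verts (image_graph f H))"
    using assms(2) by (simp add: image_graph_def bij_betw_def)
  fix x y assume xy: "x \<in> verts H" "y \<in> verts H"
  have "{x, y} \<in> edges H" if "e \<in> edges H" "f ` {x, y} = f ` e" for e
  proof -
    have "e \<subseteq> verts H" using assms(1) that(1) by (auto simp: fin_graph_def)
    then show ?thesis using that inj_on_image_eq_iff[OF assms(2), of e "{x, y}"] xy by auto
  qed
  moreover have "edges (image_graph f H) = (`) f ` edges H" by (simp add: image_graph_def)
  moreover have "{f x, f y} = f ` {x, y}" by simp
  ultimately show "{x, y} \<in> edges H \<longleftrightarrow> {f x, f y} \<in> edges (image_graph f H)"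
    by (auto simp only: image_iff)
qed

text \<open>\<open>graph_iso\<close> constrains only pairs of vertices. Since
  \<open>fin_graph\<close> holds on both sides, the edge sets consist of such pairs, so the
  isomorphism determines its target completely.\<close>

lemma image_graph_unique:
  assumes "fin_graph H" "fin_graph H'" "graph_iso f H H'"
  shows "image_graph f H = H'"
proof -
  have b: "f ` verts H = verts H'" using assms(3) by (auto simp: graph_iso_def bij_betw_def)
  have "(`) f ` edges H = edges H'"
  proof (intro equalityI subsetI)
    fix e assume "e \<in> (`) f ` edges H"
    then obtain e' where e': "e' \<in> edges H" "e = f ` e'" by auto
    with assms(1) obtain x y where "e' = {x, y}" "x \<in> verts H" "y \<in> verts H"
      by (elim fin_graph_edgeE)
    with e' assms(3) show "e \<in> edges H'" by (auto simp: graph_iso_def)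
  next
    fix e assume e: "e \<in> edges H'"
    with assms(2) obtain a b where ab: "e = {a, b}" "a \<in> verts H'" "b \<in> verts H'"
      by (elim fin_graph_edgeE)
    with b obtain x y where "x \<in> verts H" "y \<in> verts H" "a = f x" "b = f y" by blast
    with ab e assms(3) have "{x, y} \<in> edges H" "e = f ` {x, y}" by (auto simp: graph_iso_def)
    then show "e \<in> (`) f ` edges H" by blast
  qed
  with b show ?thesis by (simp add: image_graph_def)
qed

section \<open>Embeddings against copies\<close>

lemma finite_embeddings:
  assumes "fin_graph H" "fin_graph G"
  shows "finite (embeddings vs H us G)"
  by (rule finite_subset[of _ "verts H \<rightarrow>\<^sub>E verts G"])
     (use assms in \<open>auto simp: embeddings_def fin_graph_def intro!: finite_PiE\<close>)

text \<open>Rooted automorphisms act by precomposition, and the action on rooted isomorphisms onto a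
  fixed copy is free and transitive; one isomorphism \<open>f\<close> therefore parametrises all of
  them.\<close>

lemma card_rooted_isos:
  assumes f: "graph_iso f H H'" "\<forall>i<length vs. f (vs ! i) = us ! i"
    and vs: "set vs \<subseteq> verts H"
  shows "card {g \<in> extensional (verts H). graph_iso g H H' \<and> (\<forall>i<length vs. g (vs ! i) = us ! i)}
           = aut_rooted vs H" (is "card ?I = _")
proof -
  define h where "h = inv_into (verts H) f"
  let ?A = "{a \<in> automorphisms H. \<forall>v\<in>set vs. a v = v}"
  have b: "bij_betw f (verts H) (verts H')" using f by (simp add: graph_iso_def)
  have hf: "h (f x) = x" if "x \<in> verts H" for x
    using b that by (simp add: h_def bij_betw_inv_into_left)
  have fh: "f (h x) = x" if "x \<in> verts H'" for x
    using b that by (simp add: h_def bij_betw_inv_into_right)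
  have hiso: "graph_iso h H' H" unfolding h_def by (rule graph_iso_inv_into[OF f(1)])
  have aV: "a x \<in> verts H" if "a \<in> automorphisms H" "x \<in> verts H" for a x
    using that by (auto simp: automorphisms_def permutes_in_image)
  have gV: "g x \<in> verts H'" if "graph_iso g H H'" "x \<in> verts H" for g x
    using that by (auto simp: graph_iso_def dest: bij_betwE)
  \<comment> \<open>The two sides use different conventions outside \<open>verts H\<close>:
    isomorphisms are extensional, automorphisms are the identity there. Hence the restriction in one
    direction and the case distinction in the other.\<close>
  have "bij_betw (\<lambda>a. restrict (f \<circ> a) (verts H)) ?A ?I"
  proof (rule bij_betw_byWitness[where f' = "\<lambda>g x. if x \<in> verts H then h (g x) else x"])
    show "\<forall>a\<in>?A. (\<lambda>x. if x \<in> verts H then h (restrict (f \<circ> a) (verts H) x) else x) = a"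
      by (auto simp: fun_eq_iff hf aV automorphisms_def permutes_not_in)
    show "\<forall>g\<in>?I. restrict (f \<circ> (\<lambda>x. if x \<in> verts H then h (g x) else x)) (verts H) = g"
      by (auto simp: fun_eq_iff fh gV extensional_def)
    show "(\<lambda>a. restrict (f \<circ> a) (verts H)) ` ?A \<subseteq> ?I"
    proof safe
      fix a assume a: "a \<in> automorphisms H" and fix_a: "\<forall>v\<in>set vs. a v = v"
      have "graph_iso (f \<circ> a) H H'"
        using a f(1) by (auto simp: automorphisms_def intro: graph_iso_comp)
      then show "graph_iso (restrict (f \<circ> a) (verts H)) H H'"
        by (subst graph_iso_cong[where g = "f \<circ> a"]) auto
      fix i assume "i < length vs"
      then show "restrict (f \<circ> a) (verts H) (vs ! i) = us ! i"
        using fix_a f(2) vs by (auto simp: subset_iff)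
    qed auto
    show "(\<lambda>g x. if x \<in> verts H then h (g x) else x) ` ?I \<subseteq> ?A"
    proof safe
      fix g assume g: "graph_iso g H H'" and root: "\<forall>i<length vs. g (vs ! i) = us ! i"
      let ?a = "\<lambda>x. if x \<in> verts H then h (g x) else x"
      have iso: "graph_iso ?a H H"
        using graph_iso_comp[OF g hiso] by (subst graph_iso_cong[where g = "h \<circ> g"]) auto
      then have "?a permutes verts H"
        by (intro bij_imp_permutes) (auto simp: graph_iso_def)
      with iso show "?a \<in> automorphisms H" by (simp add: automorphisms_def)
      fix v assume "v \<in> set vs"
      then obtain i where "i < length vs" "v = vs ! i" by (metis in_set_conv_nth)
      then show "?a v = v" using root f(2) vs hf[of v] by (auto simp: subset_iff)
    qed
  qed
  then show ?thesis by (simp add: aut_rooted_def bij_betw_same_card)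
qed

text \<open>The embeddings are partitioned by their image graph. The fibre over a copy consists of
  the rooted isomorphisms onto it, so all fibres have size \<open>aut_rooted vs H\<close>.\<close>

lemma card_embeddings:
  assumes H: "fin_graph H" and G: "fin_graph G" and vs: "set vs \<subseteq> verts H"
    and len: "length us = length vs"
  shows "card (embeddings vs H us G) = aut_rooted vs H * rooted_count vs H us G"
proof -
  define C where "C = {H'. subgraph H' G \<and> set us \<subseteq> verts H' \<and>
     (\<exists>f. graph_iso f H H' \<and> (\<forall>i<length vs. f (vs ! i) = us ! i))}"
  have fibre: "{f \<in> embeddings vs H us G. image_graph f H = H'} =
      {g \<in> extensional (verts H). graph_iso g H H' \<and> (\<forall>i<length vs. g (vs ! i) = us ! i)}"
    if "subgraph H' G" for H'
  proof (intro equalityI subsetI)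
    fix f assume "f \<in> {f \<in> embeddings vs H us G. image_graph f H = H'}"
    then show "f \<in> {g \<in> extensional (verts H). graph_iso g H H' \<and> (\<forall>i<length vs. g (vs ! i) = us ! i)}"
      using graph_iso_image_graph[OF H] by (auto simp: embeddings_def PiE_def)
  next
    fix f assume f: "f \<in> {g \<in> extensional (verts H). graph_iso g H H' \<and>
        (\<forall>i<length vs. g (vs ! i) = us ! i)}"
    have "image_graph f H = H'"
      using f that by (intro image_graph_unique H) (auto simp: subgraph_def)
    moreover from this have "f ` verts H \<subseteq> verts G" "(`) f ` edges H \<subseteq> edges G"
      using that by (auto simp: subgraph_def image_graph_def)
    ultimately show "f \<in> {f \<in> embeddings vs H us G. image_graph f H = H'}"
      using f by (auto simp: embeddings_def PiE_def graph_iso_def bij_betw_def)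
  qed
  have C_eq: "(\<lambda>f. image_graph f H) ` embeddings vs H us G = C"
  proof (intro equalityI subsetI)
    fix H' assume "H' \<in> (\<lambda>f. image_graph f H) ` embeddings vs H us G"
    then obtain f where f: "f \<in> embeddings vs H us G" "H' = image_graph f H" by auto
    have "us ! i \<in> f ` verts H" if "i < length vs" for i
    proof -
      have "vs ! i \<in> verts H" using vs that by (auto simp: subset_iff)
      moreover have "us ! i = f (vs ! i)" using f that by (auto simp: embeddings_def)
      ultimately show ?thesis by blast
    qed
    then have "set us \<subseteq> verts H'"
      using len f by (auto simp: image_graph_def in_set_conv_nth)
    moreover have "subgraph H' G"
      using f fin_graph_image_graph[OF H, of f]
      by (auto simp: subgraph_def embeddings_def image_graph_def)
    moreover have "graph_iso f H H'"
      using f graph_iso_image_graph[OF H, of f] by (auto simp: embeddings_def)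
    moreover have "\<forall>i<length vs. f (vs ! i) = us ! i"
      using f by (simp add: embeddings_def)
    ultimately show "H' \<in> C" unfolding C_def by blast
  next
    fix H' assume "H' \<in> C"
    then obtain f where f: "subgraph H' G" "graph_iso f H H'" "\<forall>i<length vs. f (vs ! i) = us ! i"
      by (auto simp: C_def)
    \<comment> \<open>The isomorphism witnessing \<open>H' \<in> C\<close> has arbitrary values
      outside \<open>verts H\<close>; restricting it yields an element of the fibre.\<close>
    have "restrict f (verts H) \<in> {g \<in> extensional (verts H). graph_iso g H H' \<and>
        (\<forall>i<length vs. g (vs ! i) = us ! i)}"
      using f vs graph_iso_cong[of H "restrict f (verts H)" f] by (auto simp: subset_iff)
    then show "H' \<in> (\<lambda>f. image_graph f H) ` embeddings vs H us G"
      unfolding fibre[OF f(1), symmetric] by auto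
  qed
  have "card (embeddings vs H us G) =
      (\<Sum>H'\<in>C. card {f \<in> embeddings vs H us G. image_graph f H = H'})"
    using sum.image_gen[OF finite_embeddings[OF H G], of "\<lambda>_. 1" vs us "\<lambda>f. image_graph f H"]
    by (simp only: C_eq card_eq_sum)
  also have "\<dots> = (\<Sum>H'\<in>C. aut_rooted vs H)"
  proof (rule sum.cong)
    fix H' assume "H' \<in> C"
    then obtain f where f: "subgraph H' G" "graph_iso f H H'" "\<forall>i<length vs. f (vs ! i) = us ! i"
      by (auto simp: C_def)
    then show "card {f \<in> embeddings vs H us G. image_graph f H = H'} = aut_rooted vs H"
      by (simp only: fibre card_rooted_isos[OF f(2,3) vs])
  qed simp
  also have "\<dots> = aut_rooted vs H * rooted_count vs H us G"
    by (simp add: rooted_count_def C_def)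
  finally show ?thesis .
qed

lemma aut_rooted_pos:
  assumes "fin_graph H"
  shows "aut_rooted vs H > 0"
proof -
  have "finite {f \<in> automorphisms H. \<forall>v\<in>set vs. f v = v}"
    by (rule finite_subset[OF _ finite_permutations[of "verts H"]])
       (use assms in \<open>auto simp: automorphisms_def fin_graph_def\<close>)
  moreover have "id \<in> {f \<in> automorphisms H. \<forall>v\<in>set vs. f v = v}"
    by (auto simp: automorphisms_def graph_iso_def permutes_id)
  ultimately show ?thesis unfolding aut_rooted_def by (auto simp: card_gt_0_iff)
qed

lemma aut_rooted_Nil: "aut_rooted [] H = aut H"
  by (simp add: aut_rooted_def aut_def)

section \<open>Counting embeddings through common neighbourhoods\<close>

text \<open>For \<open>S = {}\<close> this is the whole vertex set, in agreement with the density
  \<open>p ^ 0\<close>. In a loopless graph it is disjoint from \<open>S\<close>.\<close>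

definition common_nbrs :: "'b graph \<Rightarrow> 'b set \<Rightarrow> 'b set" where
  "common_nbrs G S = {w \<in> verts G. \<forall>v\<in>S. {v, w} \<in> edges G}"

lemma card_embeddings_insert:
  assumes G: "fin_graph G" and H: "fin_graph (Graph (insert v W) E)" and v: "v \<notin> W"
    and vs: "set vs \<subseteq> W"
  shows "card (embeddings vs (Graph (insert v W) E) us G) =
    (\<Sum>f\<in>embeddings vs (Graph W {e \<in> E. e \<subseteq> W}) us G.
       card (common_nbrs G (f ` {u \<in> W. {u, v} \<in> E}) - f ` W))"
proof -
  let ?N = "{u \<in> W. {u, v} \<in> E}" and ?H' = "Graph W {e \<in> E. e \<subseteq> W}"
  let ?S = "SIGMA f:embeddings vs ?H' us G. common_nbrs G (f ` ?N) - f ` W"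
  have vsW: "vs ! i \<in> W" if "i < length vs" for i using that vs by (auto simp: subset_iff)
  have "bij_betw (\<lambda>(f, w). f(v := w)) ?S (embeddings vs (Graph (insert v W) E) us G)"
  proof (rule bij_betw_byWitness[where f' = "\<lambda>h. (restrict h W, h v)"])
    show "\<forall>a\<in>?S. (restrict (case a of (f, w) \<Rightarrow> f(v := w)) W, (case a of (f, w) \<Rightarrow> f(v := w)) v) = a"
      using v by (auto simp: embeddings_def fun_eq_iff PiE_def extensional_def)
    show "\<forall>h\<in>embeddings vs (Graph (insert v W) E) us G.
        (case (restrict h W, h v) of (f, w) \<Rightarrow> f(v := w)) = h"
      by (auto simp: embeddings_def fun_eq_iff PiE_def extensional_def)
    show "(\<lambda>(f, w). f(v := w)) ` ?S \<subseteq> embeddings vs (Graph (insert v W) E) us G"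
    proof safe
      fix f w assume f: "f \<in> embeddings vs ?H' us G" and w: "w \<in> common_nbrs G (f ` ?N)" "w \<notin> f ` W"
      have agree: "(f(v := w)) ` A = f ` A" if "A \<subseteq> W" for A
        using that v by (auto simp: image_iff subset_iff)
      have "(f(v := w)) ` e \<in> edges G" if e: "e \<in> E" for e
      proof (cases "e \<subseteq> W")
        case True
        then show ?thesis unfolding agree[OF True] using f e by (simp add: embeddings_def)
      next
        case False
        obtain x y where xy: "e = {x, y}" "x \<noteq> y" "x \<in> insert v W" "y \<in> insert v W"
          using fin_graph_edgeE[OF H, of e] e by auto
        then obtain u where u: "u \<in> W" "e = {u, v}" using False by auto
        then have "u \<in> ?N" using e by simp
        then have "{f u, w} \<in> edges G" using w(1) by (auto simp: common_nbrs_def)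
        moreover have "u \<noteq> v" using u v by auto
        then have "(f(v := w)) ` e = {f u, w}"
          unfolding u(2) by (simp only: image_insert image_empty fun_upd_apply simp_thms if_True if_False)
        ultimately show ?thesis by simp
      qed
      moreover have "inj_on (f(v := w)) (insert v W)"
        using f w v by (auto simp: embeddings_def inj_on_def)
      moreover have "f(v := w) \<in> insert v W \<rightarrow>\<^sub>E verts G"
        using f w(1) by (auto simp: embeddings_def common_nbrs_def PiE_def extensional_def)
      moreover have "\<forall>i<length vs. (f(v := w)) (vs ! i) = us ! i"
        using f vsW v by (auto simp: embeddings_def)
      ultimately show "f(v := w) \<in> embeddings vs (Graph (insert v W) E) us G"
        by (simp add: embeddings_def)
    qed
    show "(\<lambda>h. (restrict h W, h v)) ` embeddings vs (Graph (insert v W) E) us G \<subseteq> ?S"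
    proof (rule image_subsetI)
      fix h assume h: "h \<in> embeddings vs (Graph (insert v W) E) us G"
      have agree: "restrict h W ` A = h ` A" if "A \<subseteq> W" for A
        using that by (auto simp: image_iff subset_iff)
      have "restrict h W \<in> embeddings vs ?H' us G"
        using h vsW agree by (auto simp: embeddings_def inj_on_def)
      moreover have "h v \<in> verts G" using h by (auto simp: embeddings_def)
      moreover have "{h u, h v} \<in> edges G" if "u \<in> ?N" for u
        using h that by (force simp: embeddings_def)
      moreover have "h v \<notin> h ` W" using h v by (auto simp: embeddings_def)
      ultimately show "(restrict h W, h v) \<in> ?S"
        by (auto simp: common_nbrs_def agree)
    qed
  qed
  then have "card (embeddings vs (Graph (insert v W) E) us G) = card ?S"
    by (simp add: bij_betw_same_card)
  also have "\<dots> = (\<Sum>f\<in>embeddings vs ?H' us G. card (common_nbrs G (f ` ?N) - f ` W))"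
    using G fin_graph_induced[OF H subset_insertI] by (intro card_SigmaI finite_embeddings ballI)
      (auto simp: common_nbrs_def fin_graph_def)
  finally show ?thesis .
qed

text \<open>Edges not inside \<open>W\<close> correspond to neighbours of \<open>v\<close>. This
  makes the factors \<open>p\<close> gathered vertex by vertex multiply to
  \<open>p ^ card E\<close>.\<close>

lemma card_edges_insert:
  assumes H: "fin_graph (Graph (insert v W) E)" and v: "v \<notin> W"
  shows "card E = card {e \<in> E. e \<subseteq> W} + card {u \<in> W. {u, v} \<in> E}"
proof -
  have fE: "finite E" using finite_edges[OF H] by simp
  have "{e \<in> E. \<not> e \<subseteq> W} = (\<lambda>u. {u, v}) ` {u \<in> W. {u, v} \<in> E}"
  proof (intro equalityI subsetI)
    fix e assume e: "e \<in> {e \<in> E. \<not> e \<subseteq> W}"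
    then obtain x y where "e = {x, y}" "x \<noteq> y" "x \<in> insert v W" "y \<in> insert v W"
      using fin_graph_edgeE[OF H, of e] by auto
    then obtain u where "u \<in> W" "e = {u, v}" using e by auto
    then show "e \<in> (\<lambda>u. {u, v}) ` {u \<in> W. {u, v} \<in> E}" using e by blast
  qed (use v in auto)
  moreover have "inj_on (\<lambda>u. {u, v}) {u \<in> W. {u, v} \<in> E}"
    by (auto simp: inj_on_def doubleton_eq_iff)
  ultimately have "card {e \<in> E. \<not> e \<subseteq> W} = card {u \<in> W. {u, v} \<in> E}"
    by (simp add: card_image)
  moreover have "card E = card {e \<in> E. e \<subseteq> W} + card {e \<in> E. \<not> e \<subseteq> W}"
    using fE by (subst card_Un_disjoint[symmetric]) (auto intro: arg_cong[where f = card])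
  ultimately show ?thesis by simp
qed

text \<open>A quasirandomness condition. The error is measured against the number of all vertices
  and not against the expected count; for constant \<open>p\<close> this is equally strong up to a
  constant factor, and it keeps the errors of successive placements additive.\<close>

definition extension_regular :: "nat \<Rightarrow> real \<Rightarrow> real \<Rightarrow> 'b graph \<Rightarrow> bool" where
  "extension_regular k p \<delta> G \<longleftrightarrow> (\<forall>S\<subseteq>verts G. card S \<le> k \<longrightarrow>
     \<bar>real (card (common_nbrs G S)) - real (card (verts G)) * p ^ card S\<bar> \<le> \<delta> * real (card (verts G)))"

lemma embeddings_roots_only:
  assumes len: "length us = length vs" and vs: "distinct vs"
    and us: "distinct us" "set us \<subseteq> verts G"
  shows "card (embeddings vs (Graph (set vs) {}) us G) = 1"
proof -
  \<comment> \<open>As \<open>vs\<close> is distinct, a root has a unique position, so the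
    description operator is well defined.\<close>
  define f where "f = restrict (\<lambda>x. us ! (THE i. i < length vs \<and> vs ! i = x)) (set vs)"
  have f: "f (vs ! i) = us ! i" if "i < length vs" for i
  proof -
    have "(THE j. j < length vs \<and> vs ! j = vs ! i) = i"
      using vs that by (intro the_equality) (auto simp: nth_eq_iff_index_eq)
    then show ?thesis using that by (simp add: f_def)
  qed
  have "embeddings vs (Graph (set vs) {}) us G = {f}"
  proof (intro equalityI subsetI)
    fix g assume g: "g \<in> embeddings vs (Graph (set vs) {}) us G"
    have "g x = f x" for x
    proof (cases "x \<in> set vs")
      case True
      then show ?thesis using f g by (auto simp: in_set_conv_nth embeddings_def)
    next
      case False
      then show ?thesis using g by (auto simp: f_def embeddings_def)
    qed
    then show "g \<in> {f}" by auto
  next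
    have "f \<in> extensional (set vs)" by (simp add: f_def)
    moreover have "f x \<in> verts G" if "x \<in> set vs" for x
      using that f len by (auto simp: in_set_conv_nth intro!: subsetD[OF us(2) nth_mem])
    moreover have "inj_on f (set vs)"
      using f len us(1) by (auto simp: inj_on_def in_set_conv_nth nth_eq_iff_index_eq)
    ultimately have "f \<in> embeddings vs (Graph (set vs) {}) us G"
      using f by (auto simp: embeddings_def PiE_def)
    then show "g \<in> embeddings vs (Graph (set vs) {}) us G" if "g \<in> {f}" for g
      using that by simp
  qed
  then show ?thesis by simp
qed

text \<open>Induction on the non-root vertices, with \<open>E\<close> general because deleting a
  vertex shrinks the edge set. The two bounds are proved together: the crude one limits how many
  partial embeddings can each contribute an error, so every placement adds only one further term
  \<open>2 * \<delta> * n ^ card T\<close>. The base case is where independence of the roots enters: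
  an edge left there would join two roots.\<close>

lemma card_embeddings_approx:
  fixes p \<delta> :: real
  assumes G: "fin_graph G" and reg: "extension_regular k p \<delta> G"
    and len: "length us = length vs" and vs: "distinct vs"
    and us: "distinct us" "set us \<subseteq> verts G"
    and k: "k \<le> \<delta> * card (verts G)" and p: "0 \<le> p" "p \<le> 1"
    and T: "finite T" "T \<inter> set vs = {}"
    and H: "fin_graph (Graph (T \<union> set vs) E)" and cT: "card (T \<union> set vs) \<le> k"
    and indep: "\<forall>x\<in>set vs. \<forall>y\<in>set vs. {x, y} \<notin> E"
  defines "n \<equiv> card (verts G)"
  shows "card (embeddings vs (Graph (T \<union> set vs) E) us G) \<le> n ^ card T \<and>
    \<bar>card (embeddings vs (Graph (T \<union> set vs) E) us G) - real n ^ card T * p ^ card E\<bar>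
      \<le> 2 * card T * \<delta> * real n ^ card T"
  using T H cT indep
proof (induction T arbitrary: E rule: finite_induct)
  case empty
  have "E = {}"
  proof (rule ccontr)
    assume "E \<noteq> {}"
    then obtain e where e: "e \<in> E" by blast
    obtain x y where "e = {x, y}" "x \<in> set vs" "y \<in> set vs"
      by (rule fin_graph_edgeE[OF empty(2), of e]) (use e in auto)
    with e empty(4) show False by blast
  qed
  then show ?case using embeddings_roots_only[OF len vs us] by simp
next
  case (insert v T)
  let ?W = "T \<union> set vs"
  let ?E' = "{e \<in> E. e \<subseteq> ?W}" and ?N = "{u \<in> ?W. {u, v} \<in> E}"
  let ?F = "embeddings vs (Graph ?W ?E') us G"
  let ?c = "\<lambda>f. card (common_nbrs G (f ` ?N) - f ` ?W)"
  have v: "v \<notin> ?W" using insert by auto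
  have H: "fin_graph (Graph (insert v ?W) E)" using insert by simp
  have H': "fin_graph (Graph ?W ?E')" using fin_graph_induced[OF H] by blast
  have cW: "card ?W \<le> k"
  proof -
    have "card ?W \<le> card (insert v T \<union> set vs)" using insert by (intro card_mono) auto
    then show ?thesis using insert by linarith
  qed
  have IH: "card ?F \<le> n ^ card T"
      "\<bar>card ?F - real n ^ card T * p ^ card ?E'\<bar> \<le> 2 * card T * \<delta> * real n ^ card T"
    using insert.IH[OF _ H' cW] insert.prems by auto
  have card_eq: "card (embeddings vs (Graph (insert v T \<union> set vs) E) us G) = (\<Sum>f\<in>?F. ?c f)"
    using card_embeddings_insert[OF G H v, of vs us] by simp
  have fG: "finite (verts G)" using G by (simp add: fin_graph_def)
  have cn: "?c f \<le> n" for f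
    unfolding n_def by (intro card_mono fG) (auto simp: common_nbrs_def)
  \<comment> \<open>One \<open>\<delta> * n\<close> comes from regularity at the images of the
    neighbours of \<open>v\<close>; the other pays for the at most
    \<open>k \<le> \<delta> * n\<close> vertices already occupied.\<close>
  have capprox: "\<bar>?c f - n * p ^ card ?N\<bar> \<le> 2 * \<delta> * n" if f: "f \<in> ?F" for f
  proof -
    have "inj_on f ?N" using f by (auto simp: embeddings_def inj_on_def)
    then have cN: "card (f ` ?N) = card ?N" by (rule card_image)
    also have "\<dots> \<le> card ?W" by (intro card_mono) (use insert in auto)
    finally have "card (f ` ?N) \<le> k" using cW by simp
    moreover have "f ` ?N \<subseteq> verts G" using f by (auto simp: embeddings_def)
    ultimately have 1: "\<bar>real (card (common_nbrs G (f ` ?N))) - n * p ^ card ?N\<bar> \<le> \<delta> * n"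
      using reg unfolding extension_regular_def cN[symmetric] n_def by blast
    have "?c f \<le> card (common_nbrs G (f ` ?N))"
      using fG by (intro card_mono) (auto simp: common_nbrs_def)
    moreover have "card (common_nbrs G (f ` ?N)) \<le> ?c f + card (f ` ?W)"
      using diff_card_le_card_Diff[of "f ` ?W" "common_nbrs G (f ` ?N)"] insert.hyps by simp
    moreover have "card (f ` ?W) \<le> card ?W" by (intro card_image_le) (use insert in auto)
    ultimately have "real (?c f) \<le> card (common_nbrs G (f ` ?N))"
      "real (card (common_nbrs G (f ` ?N))) \<le> ?c f + k" using cW by linarith+
    then show ?thesis using 1 k unfolding n_def[symmetric] by linarith
  qed
  have "(\<Sum>f\<in>?F. ?c f) \<le> (\<Sum>f\<in>?F. n)" by (intro sum_mono cn)
  also have "\<dots> \<le> n ^ card T * n" using IH(1) by simp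
  finally have upper: "(\<Sum>f\<in>?F. ?c f) \<le> n ^ card (insert v T)"
    using insert.hyps by (simp add: mult.commute)
  let ?q = "p ^ card ?N"
  have \<delta>n: "0 \<le> \<delta> * n" using k unfolding n_def[symmetric] by linarith
  \<comment> \<open>Bound A freezes the number of choices for the new vertex at
    \<open>n * ?q\<close>, at a cost of \<open>2 * \<delta> * n\<close> for each partial
    embedding.\<close>
  have "\<bar>real (\<Sum>f\<in>?F. ?c f) - card ?F * (n * ?q)\<bar> = \<bar>\<Sum>f\<in>?F. (?c f - n * ?q)\<bar>"
    by (simp add: sum_subtractf)
  also have "\<dots> \<le> (\<Sum>f\<in>?F. \<bar>?c f - n * ?q\<bar>)" by (rule sum_abs)
  also have "\<dots> \<le> (\<Sum>f\<in>?F. 2 * \<delta> * n)" by (intro sum_mono capprox)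
  also have "\<dots> = card ?F * (2 * (\<delta> * n))" by simp
  also have "\<dots> \<le> real (n ^ card T) * (2 * (\<delta> * n))"
    using \<delta>n IH(1) by (intro mult_right_mono) (auto simp del: of_nat_power)
  finally have A: "\<bar>real (\<Sum>f\<in>?F. ?c f) - card ?F * (n * ?q)\<bar> \<le> 2 * \<delta> * real n ^ Suc (card T)"
    by (simp add: algebra_simps)
  \<comment> \<open>Bound B replaces the number of partial embeddings by its estimate; the old error
    is multiplied by \<open>n * ?q\<close>, which is at most \<open>n\<close>.\<close>
  have "\<bar>card ?F * (n * ?q) - real n ^ card T * p ^ card ?E' * (n * ?q)\<bar>
      = \<bar>card ?F - real n ^ card T * p ^ card ?E'\<bar> * (n * ?q)"
    using p by (simp add: left_diff_distrib[symmetric] abs_mult)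
  also have "\<dots> \<le> \<bar>card ?F - real n ^ card T * p ^ card ?E'\<bar> * n"
    using p by (intro mult_left_mono mult_left_le power_le_one) auto
  also have "\<dots> \<le> (2 * card T * \<delta> * real n ^ card T) * n"
    using IH(2) by (intro mult_right_mono) auto
  finally have B: "\<bar>card ?F * (n * ?q) - real n ^ card T * p ^ card ?E' * (n * ?q)\<bar>
      \<le> 2 * card T * \<delta> * real n ^ Suc (card T)" by (simp add: algebra_simps)
  have "p ^ card E = p ^ card ?E' * ?q"
    using card_edges_insert[OF H v] by (simp add: power_add)
  then have C: "real n ^ Suc (card T) * p ^ card E = real n ^ card T * p ^ card ?E' * (n * ?q)"
    by simp
  have "\<bar>real (\<Sum>f\<in>?F. ?c f) - real n ^ Suc (card T) * p ^ card E\<bar>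
      \<le> 2 * \<delta> * real n ^ Suc (card T) + 2 * card T * \<delta> * real n ^ Suc (card T)"
    unfolding C using A B by linarith
  also have "\<dots> = 2 * Suc (card T) * \<delta> * real n ^ Suc (card T)" by (simp add: algebra_simps)
  finally show ?case using upper insert.hyps unfolding card_eq by simp
qed

section \<open>Common neighbourhoods in the random graph\<close>

lemma finite_vertex_pairs: "finite (vertex_pairs n)"
  by (rule finite_subset[of _ "Pow {1..n}"]) (auto simp: vertex_pairs_def)

lemma gnp_support:
  assumes "G \<in> set_pmf (gnp n p)"
  shows "fin_graph G" "verts G = {1..n}"
proof -
  have *: "verts G = {1..n}" "edges G \<subseteq> vertex_pairs n"
    using assms by (auto simp: gnp_def)
  then show "verts G = {1..n}" by simp
  show "fin_graph G"
    unfolding fin_graph_def using * unfolding vertex_pairs_def by auto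
qed

text \<open>Settles all integrability questions: every real function is integrable over a finitely
  supported distribution.\<close>

lemma finite_set_pmf_gnp: "finite (set_pmf (gnp n p))"
proof -
  have "set_pmf (gnp n p) \<subseteq> (\<lambda>E. Graph {1..n} E) ` Pow (vertex_pairs n)"
    by (auto simp: gnp_def)
  then show ?thesis by (rule finite_subset) (simp add: finite_vertex_pairs)
qed

text \<open>The event is a box in the product space, with side \<open>{True}\<close> at coordinates
  in \<open>F\<close> and no restriction elsewhere.\<close>

lemma prob_Pi_bernoulli_all:
  assumes "finite A" "F \<subseteq> A" "0 \<le> p" "p \<le> 1"
  shows "measure_pmf.prob (Pi_pmf A False (\<lambda>_. bernoulli_pmf p)) {\<omega>. \<forall>e\<in>F. \<omega> e} = p ^ card F"
proof -
  have "{\<omega>. \<forall>e\<in>F. \<omega> e} = Pi A (\<lambda>e. if e \<in> F then {True} else UNIV)"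
    using assms(2) by (fastforce simp: Pi_iff split: if_splits)
  then have "measure_pmf.prob (Pi_pmf A False (\<lambda>_. bernoulli_pmf p)) {\<omega>. \<forall>e\<in>F. \<omega> e} =
      (\<Prod>e\<in>A. measure_pmf.prob (bernoulli_pmf p) (if e \<in> F then {True} else UNIV))"
    using assms(1) by (simp add: measure_Pi_pmf_Pi)
  also have "\<dots> = (\<Prod>e\<in>A. if e \<in> F then p else 1)"
    using assms by (intro prod.cong) (auto simp: measure_pmf_single)
  also have "\<dots> = (\<Prod>e\<in>F. p)"
    using assms by (simp add: prod.If_cases Int_absorb1)
  finally show ?thesis by simp
qed

lemma prob_gnp_edges:
  assumes "F \<subseteq> vertex_pairs n" "0 \<le> p" "p \<le> 1"
  shows "measure_pmf.prob (gnp n p) {G. F \<subseteq> edges G} = p ^ card F"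
proof -
  have "(\<lambda>\<omega>. Graph {1..n} {e \<in> vertex_pairs n. \<omega> e}) -` {G. F \<subseteq> edges G} = {\<omega>. \<forall>e\<in>F. \<omega> e}"
    using assms(1) by auto
  then show ?thesis
    using assms by (simp add: gnp_def prob_Pi_bernoulli_all finite_vertex_pairs)
qed

text \<open>For different \<open>w\<close> outside \<open>S\<close>, being joined to all of
  \<open>S\<close> depends on disjoint sets of pairs. The count is thus a sum of independent
  indicators and Hoeffding's inequality applies.\<close>

lemma prob_common_nbrs:
  fixes p \<delta> :: real
  assumes p: "0 \<le> p" "p \<le> 1" and \<delta>: "\<delta> > 0" and S: "S \<subseteq> {1..n}"
    and n: "card S < n" "2 * card S \<le> \<delta> * n"
  shows "measure_pmf.prob (gnp n p) {G. \<bar>real (card (common_nbrs G S)) - n * p ^ card S\<bar> > \<delta> * n}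
           \<le> 2 * exp (- \<delta>\<^sup>2 * n / 2)"
proof -
  define M where "M = Pi_pmf (vertex_pairs n) False (\<lambda>_. bernoulli_pmf p)"
  define I where "I = {1..n} - S"
  define K where "K = (\<lambda>w. (\<lambda>v. {v, w}) ` S)"
  define X where "X = (\<lambda>w \<omega>. of_bool (\<forall>e\<in>K w. \<omega> e) :: real)"
  have fS: "finite S" using S finite_subset by blast
  have fI: "finite I" and cI: "card I = n - card S"
    using S fS by (auto simp: I_def card_Diff_subset)
  have Kvp: "K w \<subseteq> vertex_pairs n" if "w \<in> I" for w
    using that S by (auto simp: K_def I_def vertex_pairs_def card_insert_if)
  have fK: "finite (K w)" for w using fS by (simp add: K_def)
  have cK: "card (K w) = card S" for w
    unfolding K_def by (intro card_image) (auto simp: inj_on_def doubleton_eq_iff)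
  \<comment> \<open>A pair shared by \<open>K w\<close> and \<open>K w'\<close> with
    \<open>w \<noteq> w'\<close> would force \<open>w' \<in> S\<close>, contrary to
    \<open>w' \<in> I\<close>.\<close>
  have disj: "disjoint_family_on K I"
    by (auto simp: disjoint_family_on_def K_def I_def doubleton_eq_iff)
  have "prob_space.indep_vars (measure_pmf M) (\<lambda>w. PiM (K w) (\<lambda>_. count_space UNIV)) (\<lambda>w \<omega>. restrict (\<lambda>e. \<omega> e) (K w)) I"
    unfolding M_def
    by (rule prob_space.indep_vars_restrict[OF measure_pmf.prob_space_axioms
          indep_vars_Pi_pmf[OF finite_vertex_pairs]])
       (use Kvp disj in auto)
  then have "prob_space.indep_vars (measure_pmf M) (\<lambda>_. borel)
      (\<lambda>w \<omega>. (\<lambda>g. of_bool (\<forall>e\<in>K w. g e) :: real) (restrict (\<lambda>e. \<omega> e) (K w))) I"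
  proof (rule prob_space.indep_vars_compose2[OF measure_pmf.prob_space_axioms])
    fix w assume "w \<in> I"
    \<comment> \<open>With \<open>K w\<close> finite, the quantifier is a finite conjunction of
      measurable conditions.\<close>
    have [measurable]: "finite (K w)" by (rule fK)
    show "(\<lambda>g. of_bool (\<forall>e\<in>K w. g e) :: real) \<in> borel_measurable (PiM (K w) (\<lambda>_. count_space UNIV))"
      by measurable
  qed
  moreover have "(\<lambda>w \<omega>. (\<lambda>g. of_bool (\<forall>e\<in>K w. g e) :: real) (restrict (\<lambda>e. \<omega> e) (K w))) = X"
    by (auto simp: X_def fun_eq_iff)
  ultimately have indep: "prob_space.indep_vars (measure_pmf M) (\<lambda>_. borel) X I" by simp
  define \<mu> where "\<mu> = (\<Sum>w\<in>I. measure_pmf.expectation M (X w))"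
  interpret H: Hoeffding_ineq "measure_pmf M" I X "\<lambda>_. 0" "\<lambda>_. 1" \<mu>
  proof unfold_locales
    show "finite I" by (rule fI)
    show "prob_space.indep_vars (measure_pmf M) (\<lambda>_. borel) X I" by (rule indep)
    show "AE \<omega> in M. X w \<omega> \<in> {0..1}" for w by (simp add: X_def)
    show "\<mu> \<equiv> \<Sum>w\<in>I. measure_pmf.expectation M (X w)" by (rule eq_reflection) (rule \<mu>_def)
  qed
  have "measure_pmf.expectation M (X w) = p ^ card S" if "w \<in> I" for w
  proof -
    have "X w = indicator {\<omega>. \<forall>e\<in>K w. \<omega> e}" by (auto simp: X_def fun_eq_iff)
    then have "measure_pmf.expectation M (X w) = measure_pmf.prob M {\<omega>. \<forall>e\<in>K w. \<omega> e}" by simp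
    then show ?thesis
      using prob_Pi_bernoulli_all[OF finite_vertex_pairs Kvp[OF that] p] by (simp add: M_def cK)
  qed
  then have \<mu>: "\<mu> = (real n - card S) * p ^ card S"
    using cI n by (simp add: \<mu>_def of_nat_diff)
  have sum: "card (common_nbrs (Graph {1..n} {e \<in> vertex_pairs n. \<omega> e}) S) = (\<Sum>w\<in>I. X w \<omega>)" for \<omega>
  proof -
    have 1: "{v, w} \<in> vertex_pairs n" if "w \<in> I" "v \<in> S" for v w
      using Kvp that by (auto simp: K_def)
    \<comment> \<open>A vertex of \<open>S\<close> would have to be joined to itself, so summing
      over \<open>I\<close> misses no common neighbour.\<close>
    have 2: "{w} \<notin> vertex_pairs n" for w by (simp add: vertex_pairs_def)
    have "common_nbrs (Graph {1..n} {e \<in> vertex_pairs n. \<omega> e}) S = {w \<in> I. \<forall>e\<in>K w. \<omega> e}"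
      using 1 2 by (auto simp: common_nbrs_def I_def K_def)
    then show ?thesis using fI by (simp add: X_def Int_def)
  qed
  \<comment> \<open>Half of the deviation is spent on centring: the true mean counts only
    \<open>n - card S\<close> candidates and so differs from \<open>n * p ^ card S\<close> by at
    most \<open>card S \<le> \<delta> * n / 2\<close>.\<close>
  have "\<delta> / 2 * n \<le> \<bar>(\<Sum>w\<in>I. X w \<omega>) - \<mu>\<bar>" if "\<delta> * n < \<bar>(\<Sum>w\<in>I. X w \<omega>) - n * p ^ card S\<bar>" for \<omega>
  proof -
    have "real (card S) * p ^ card S \<le> real (card S)"
      using p by (intro mult_left_le power_le_one) auto
    moreover have "0 \<le> real (card S) * p ^ card S" using p by simp
    ultimately have "\<bar>\<mu> - n * p ^ card S\<bar> \<le> card S" by (simp add: \<mu> algebra_simps)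
    then show ?thesis using that n(2) by linarith
  qed
  then have "measure_pmf.prob (gnp n p) {G. \<bar>real (card (common_nbrs G S)) - n * p ^ card S\<bar> > \<delta> * n}
      \<le> measure_pmf.prob M {\<omega> \<in> space (measure_pmf M). \<delta> / 2 * n \<le> \<bar>(\<Sum>w\<in>I. X w \<omega>) - \<mu>\<bar>}"
    unfolding gnp_def M_def[symmetric] measure_map_pmf
    by (intro measure_pmf.finite_measure_mono) (auto simp: sum simp del: One_nat_def)
  also have "\<dots> \<le> 2 * exp (- 2 * (\<delta> / 2 * n)\<^sup>2 / (\<Sum>w\<in>I. (1 - 0)\<^sup>2))"
    using \<delta> cI n by (intro H.Hoeffding_ineq_abs_ge) auto
  also have "\<dots> \<le> 2 * exp (- \<delta>\<^sup>2 * n / 2)"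
  proof -
    have "\<delta>\<^sup>2 * n / 2 = 2 * (\<delta> / 2 * n)\<^sup>2 / n" using n by (simp add: power2_eq_square)
    also have "\<dots> \<le> 2 * (\<delta> / 2 * n)\<^sup>2 / card I" using n cI by (intro divide_left_mono) auto
    finally show ?thesis by simp
  qed
  finally show ?thesis .
qed

lemma card_subsets_le:
  assumes "k \<le> n"
  shows "card {S. S \<subseteq> {1..n} \<and> card S \<le> k} \<le> (\<Sum>j\<le>k. n ^ j)"
proof -
  have "{S. S \<subseteq> {1..n} \<and> card S \<le> k} = (\<Union>j\<le>k. {S. S \<subseteq> {1..n} \<and> card S = j})" by auto
  also have "card \<dots> \<le> (\<Sum>j\<le>k. card {S. S \<subseteq> {1..n} \<and> card S = j})" by (intro card_UN_le) auto
  also have "\<dots> \<le> (\<Sum>j\<le>k. n ^ j)"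
    using assms by (intro sum_mono) (auto simp: n_subsets intro: binomial_le_pow)
  finally show ?thesis .
qed

lemma gnp_extension_regular:
  fixes p \<delta> :: real
  assumes p: "0 \<le> p" "p \<le> 1" and \<delta>: "\<delta> > 0"
  shows "(\<lambda>n. measure_pmf.prob (gnp n p) {G. \<not> extension_regular k p \<delta> G}) \<longlonglongrightarrow> 0"
proof (rule tendsto_sandwich)
  show "\<forall>\<^sub>F n in sequentially. 0 \<le> measure_pmf.prob (gnp n p) {G. \<not> extension_regular k p \<delta> G}"
    by simp
  have "(\<lambda>n. (\<Sum>j\<le>k. real n ^ j * (2 * exp (- \<delta>\<^sup>2 * n / 2)))) \<longlonglongrightarrow> (\<Sum>j\<le>k. 0)"
    using \<delta> by (intro tendsto_sum) real_asymp
  then show "(\<lambda>n. (\<Sum>j\<le>k. real n ^ j * (2 * exp (- \<delta>\<^sup>2 * n / 2)))) \<longlonglongrightarrow> 0" by simp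
  have "\<forall>\<^sub>F n in sequentially. 2 * real k \<le> \<delta> * real n" using \<delta> by real_asymp
  then show "\<forall>\<^sub>F n in sequentially. measure_pmf.prob (gnp n p) {G. \<not> extension_regular k p \<delta> G}
      \<le> (\<Sum>j\<le>k. real n ^ j * (2 * exp (- \<delta>\<^sup>2 * n / 2)))"
    using eventually_gt_at_top[of k]
  proof eventually_elim
    case (elim n)
    let ?Ss = "{S. S \<subseteq> {1..n} \<and> card S \<le> k}"
    let ?B = "\<lambda>S. {G. \<bar>real (card (common_nbrs G S)) - n * p ^ card S\<bar> > \<delta> * n}"
    \<comment> \<open>The inclusion of events needs \<open>verts G = {1..n}\<close>, which is known
      only on the support; hence the almost sure form.\<close>
    have "AE G in gnp n p. G \<in> {G. \<not> extension_regular k p \<delta> G} \<longrightarrow> G \<in> (\<Union>S\<in>?Ss. ?B S)"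
      by (intro AE_pmfI) (auto simp: gnp_support extension_regular_def not_le)
    then have "measure_pmf.prob (gnp n p) {G. \<not> extension_regular k p \<delta> G}
        \<le> measure_pmf.prob (gnp n p) (\<Union>S\<in>?Ss. ?B S)"
      by (rule measure_pmf.finite_measure_mono_AE) simp
    also have "\<dots> \<le> (\<Sum>S\<in>?Ss. measure_pmf.prob (gnp n p) (?B S))"
      by (intro measure_pmf.finite_measure_subadditive_finite) auto
    also have "\<dots> \<le> (\<Sum>S\<in>?Ss. 2 * exp (- \<delta>\<^sup>2 * n / 2))"
      using elim by (intro sum_mono prob_common_nbrs p \<delta>) auto
    also have "\<dots> \<le> real (\<Sum>j\<le>k. n ^ j) * (2 * exp (- \<delta>\<^sup>2 * n / 2))"
      using card_subsets_le[of k n] elim by (simp del: of_nat_sum)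
    finally show ?case by (simp add: sum_distrib_right)
  qed
qed simp

section \<open>Concentration of bounded variables\<close>

text \<open>A bounded convergence theorem for measures that change with \<open>n\<close>. Cutting at
  a threshold \<open>\<eta>\<close> leaves at most \<open>\<eta> powr q\<close> below it and
  \<open>B powr q\<close> times a vanishing probability above it. No convexity is involved, so
  exponents below 1 are covered.\<close>

lemma expectation_powr_tendsto_0:
  fixes M :: "nat \<Rightarrow> 'a pmf" and Z :: "nat \<Rightarrow> 'a \<Rightarrow> real"
  assumes fin: "\<And>n. finite (set_pmf (M n))" and nonneg: "\<And>n x. 0 \<le> Z n x"
    and bounded: "\<forall>\<^sub>F n in sequentially. \<forall>x\<in>set_pmf (M n). Z n x \<le> B"
    and prob: "\<And>\<epsilon>. \<epsilon> > 0 \<Longrightarrow> (\<lambda>n. measure_pmf.prob (M n) {x. Z n x > \<epsilon>}) \<longlonglongrightarrow> 0"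
    and q: "q > 0"
  shows "(\<lambda>n. measure_pmf.expectation (M n) (\<lambda>x. Z n x powr q)) \<longlonglongrightarrow> 0"
proof (rule order_tendstoI)
  fix a :: real assume "a < 0"
  moreover have "0 \<le> measure_pmf.expectation (M n) (\<lambda>x. Z n x powr q)" for n
    by (intro Bochner_Integration.integral_nonneg) simp
  ultimately show "\<forall>\<^sub>F n in sequentially. a < measure_pmf.expectation (M n) (\<lambda>x. Z n x powr q)"
    by (auto intro!: always_eventually intro: less_le_trans)
next
  fix a :: real assume a: "0 < a"
  \<comment> \<open>Chosen so that \<open>\<eta> powr q\<close> is half of the permitted
    \<open>a\<close>.\<close>
  define \<eta> where "\<eta> = (a / 2) powr (1 / q)"
  have \<eta>: "\<eta> > 0" "\<eta> powr q = a / 2" using a q by (auto simp: \<eta>_def powr_powr)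
  have "(\<lambda>n. B powr q * measure_pmf.prob (M n) {x. Z n x > \<eta>}) \<longlonglongrightarrow> B powr q * 0"
    by (intro tendsto_intros prob \<eta>)
  then have "\<forall>\<^sub>F n in sequentially. B powr q * measure_pmf.prob (M n) {x. Z n x > \<eta>} < a / 2"
    using a by (intro order_tendstoD(2)) auto
  with bounded show "\<forall>\<^sub>F n in sequentially. measure_pmf.expectation (M n) (\<lambda>x. Z n x powr q) < a"
  proof eventually_elim
    case (elim n)
    have int: "integrable (M n) f" for f :: "'a \<Rightarrow> real"
      by (rule integrable_measure_pmf_finite[OF fin])
    have "measure_pmf.expectation (M n) (\<lambda>x. Z n x powr q)
        \<le> measure_pmf.expectation (M n) (\<lambda>x. \<eta> powr q + B powr q * indicator {x. Z n x > \<eta>} x)"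
    proof (intro integral_mono_AE int AE_pmfI)
      fix x assume "x \<in> set_pmf (M n)"
      then have "Z n x \<le> B" using elim by simp
      then have "Z n x powr q \<le> B powr q"
        using nonneg[of n x] q by (intro powr_mono2) auto
      moreover have "Z n x powr q \<le> \<eta> powr q" if "Z n x \<le> \<eta>"
        using nonneg[of n x] q that by (intro powr_mono2) auto
      ultimately show "Z n x powr q \<le> \<eta> powr q + B powr q * indicator {x. Z n x > \<eta>} x"
        using \<eta>(2) a by (auto simp: indicator_def)
    qed
    also have "\<dots> = \<eta> powr q + B powr q * measure_pmf.prob (M n) {x. Z n x > \<eta>}"
      by (simp add: int)
    finally show ?case using elim \<eta> by simp
  qed
qed

text \<open>Concentration normalises by the true mean, whereas counting controls
  \<open>X n / s n\<close> for an explicit scale \<open>s\<close>. The exponent 1 first shows that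
  mean over scale tends to \<open>c\<close>; positivity of \<open>c\<close> then permits exchanging
  the two normalisations.\<close>

lemma concentrated_if_tendsto_in_prob:
  fixes M :: "nat \<Rightarrow> 'a pmf" and X :: "nat \<Rightarrow> 'a \<Rightarrow> real"
  assumes fin: "\<And>n. finite (set_pmf (M n))" and c: "c > 0"
    and s: "\<forall>\<^sub>F n in sequentially. s n > 0"
    and bounded: "\<forall>\<^sub>F n in sequentially. \<forall>x\<in>set_pmf (M n). \<bar>X n x / s n\<bar> \<le> B"
    and prob: "\<And>\<epsilon>. \<epsilon> > 0 \<Longrightarrow> (\<lambda>n. measure_pmf.prob (M n) {x. \<bar>X n x / s n - c\<bar> > \<epsilon>}) \<longlonglongrightarrow> 0"
  shows "concentrated_around_mean M X"
    and "(\<lambda>n. measure_pmf.expectation (M n) (X n) / s n) \<longlonglongrightarrow> c"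
proof -
  have int: "integrable (M n) f" for f :: "'a \<Rightarrow> real" and n
    by (rule integrable_measure_pmf_finite[OF fin])
  define m where "m = (\<lambda>n. measure_pmf.expectation (M n) (X n) / s n)"
  have "(\<lambda>n. measure_pmf.expectation (M n) (\<lambda>x. \<bar>X n x / s n - c\<bar> powr 1)) \<longlonglongrightarrow> 0"
  proof (rule expectation_powr_tendsto_0[where B = "B + c", OF fin _ _ prob])
    show "\<forall>\<^sub>F n in sequentially. \<forall>x\<in>set_pmf (M n). \<bar>X n x / s n - c\<bar> \<le> B + c"
      using bounded by eventually_elim (use c in \<open>fastforce intro: order_trans[OF abs_triangle_ineq4]\<close>)
  qed auto
  then have "(\<lambda>n. m n - c) \<longlonglongrightarrow> 0"
  proof (rule Lim_null_comparison[rotated], intro always_eventually allI)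
    fix n
    have "m n - c = measure_pmf.expectation (M n) (\<lambda>x. X n x / s n - c)"
      by (simp add: m_def int)
    also have "\<bar>\<dots>\<bar> \<le> measure_pmf.expectation (M n) (\<lambda>x. \<bar>X n x / s n - c\<bar>)"
      by (rule integral_abs_bound)
    finally show "norm (m n - c) \<le> measure_pmf.expectation (M n) (\<lambda>x. \<bar>X n x / s n - c\<bar> powr 1)"
      by simp
  qed
  then have m: "m \<longlonglongrightarrow> c" by (simp add: LIM_zero_iff)
  then show "(\<lambda>n. measure_pmf.expectation (M n) (X n) / s n) \<longlonglongrightarrow> c" by (simp add: m_def)
  define Z where "Z = (\<lambda>n x. \<bar>X n x / measure_pmf.expectation (M n) (X n) - 1\<bar>)"
  \<comment> \<open>Once \<open>m n > c / 2\<close>, dividing by \<open>m n\<close> costs at most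
    the factor \<open>2 / c\<close>. This transfers both boundedness and convergence in probability
    to \<open>Z\<close>.\<close>
  have Z_le: "Z n x \<le> (\<bar>X n x / s n - c\<bar> + \<bar>m n - c\<bar>) * (2 / c)" if "s n > 0" "m n > c / 2" for n x
  proof -
    have m0: "m n > 0" using that c by linarith
    have "measure_pmf.expectation (M n) (X n) = s n * m n" using that by (simp add: m_def)
    then have "Z n x = \<bar>(X n x / s n - m n) / m n\<bar>"
      using that m0 by (simp add: Z_def diff_divide_distrib)
    also have "\<dots> = \<bar>X n x / s n - m n\<bar> / m n" using m0 by simp
    also have "\<dots> \<le> \<bar>X n x / s n - m n\<bar> / (c / 2)"
      using that m0 c by (intro divide_left_mono) auto
    also have "\<dots> \<le> (\<bar>X n x / s n - c\<bar> + \<bar>m n - c\<bar>) / (c / 2)"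
      using c by (intro divide_right_mono) auto
    finally show ?thesis by simp
  qed
  have m_large: "\<forall>\<^sub>F n in sequentially. m n > c / 2"
    using m c by (intro order_tendstoD(1)) auto
  have m_close: "\<forall>\<^sub>F n in sequentially. \<bar>m n - c\<bar> < \<epsilon>" if "\<epsilon> > 0" for \<epsilon>
    using tendstoD[OF m that] by (simp add: dist_real_def)
  have "(\<lambda>n. measure_pmf.expectation (M n) (\<lambda>x. Z n x powr q)) \<longlonglongrightarrow> 0" if q: "q > 0" for q
  proof (rule expectation_powr_tendsto_0[where B = "(B + c + 1) * (2 / c)", OF fin _ _ _ q])
    show "\<forall>\<^sub>F n in sequentially. \<forall>x\<in>set_pmf (M n). Z n x \<le> (B + c + 1) * (2 / c)"
      using bounded s m_large m_close[of 1, simplified]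
    proof eventually_elim
      case (elim n)
      show ?case
      proof
        fix x assume "x \<in> set_pmf (M n)"
        then have "\<bar>X n x / s n\<bar> \<le> B" using elim by blast
        then have "\<bar>X n x / s n - c\<bar> + \<bar>m n - c\<bar> \<le> B + c + 1"
          using elim c by linarith
        then have "(\<bar>X n x / s n - c\<bar> + \<bar>m n - c\<bar>) * (2 / c) \<le> (B + c + 1) * (2 / c)"
          using c by (intro mult_right_mono) auto
        with Z_le[of n x] elim show "Z n x \<le> (B + c + 1) * (2 / c)" by linarith
      qed
    qed
  next
    fix \<epsilon> :: real assume \<epsilon>: "\<epsilon> > 0"
    \<comment> \<open>Two errors of size \<open>\<eta>\<close>, multiplied by \<open>2 / c\<close>,
      add up to \<open>\<epsilon>\<close>.\<close>
    define \<eta> where "\<eta> = \<epsilon> * c / 4"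
    have \<eta>: "\<eta> > 0" using \<epsilon> c by (simp add: \<eta>_def)
    show "(\<lambda>n. measure_pmf.prob (M n) {x. Z n x > \<epsilon>}) \<longlonglongrightarrow> 0"
    proof (rule Lim_null_comparison[OF _ prob[OF \<eta>]])
      show "\<forall>\<^sub>F n in sequentially. norm (measure_pmf.prob (M n) {x. Z n x > \<epsilon>})
          \<le> measure_pmf.prob (M n) {x. \<bar>X n x / s n - c\<bar> > \<eta>}"
        using s m_large m_close[OF \<eta>]
      proof eventually_elim
        case (elim n)
        have "\<bar>X n x / s n - c\<bar> > \<eta>" if "Z n x > \<epsilon>" for x
        proof (rule ccontr)
          assume "\<not> \<bar>X n x / s n - c\<bar> > \<eta>"
          then have "(\<bar>X n x / s n - c\<bar> + \<bar>m n - c\<bar>) * (2 / c) \<le> (\<eta> + \<eta>) * (2 / c)"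
            using elim c by (intro mult_right_mono) auto
          also have "\<dots> = \<epsilon>" using c by (simp add: \<eta>_def)
          finally show False using Z_le[of n x] elim that by linarith
        qed
        then show ?case by (auto intro!: measure_pmf.finite_measure_mono)
      qed
    qed
  qed (simp add: Z_def)
  then show "concentrated_around_mean M X"
    by (auto simp: concentrated_around_mean_def Z_def int)
qed

section \<open>Rooted counts in the random graph\<close>

text \<open>Makes the upper bound of \<open>rooted_count_approx\<close> available for every graph.\<close>

lemma extension_regular_1:
  assumes "fin_graph G" "0 \<le> p" "p \<le> 1"
  shows "extension_regular k p 1 G"
  unfolding extension_regular_def
proof (intro allI impI)
  fix S
  have "card (common_nbrs G S) \<le> card (verts G)"
    using assms by (intro card_mono) (auto simp: common_nbrs_def fin_graph_def)
  moreover have "real (card (verts G)) * p ^ card S \<le> real (card (verts G))"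
      "0 \<le> real (card (verts G)) * p ^ card S"
    using assms by (auto intro: mult_left_le power_le_one)
  ultimately show "\<bar>real (card (common_nbrs G S)) - real (card (verts G)) * p ^ card S\<bar> \<le> 1 * real (card (verts G))"
    by linarith
qed

text \<open>The bounds do not mention \<open>us\<close>; this uniformity is what allows a tuple
  chosen after seeing the graph.\<close>

lemma rooted_count_approx:
  fixes p \<delta> :: real
  assumes H: "fin_graph H" and G: "fin_graph G" and p: "0 \<le> p" "p \<le> 1"
    and vs: "distinct vs" "set vs \<subseteq> verts H" "\<forall>x\<in>set vs. \<forall>y\<in>set vs. {x, y} \<notin> edges H"
    and us: "us \<in> root_tuples (card (verts G)) (length vs)" "verts G = {1..card (verts G)}"
    and k: "card (verts H) \<le> \<delta> * card (verts G)"
    and reg: "extension_regular (card (verts H)) p \<delta> G"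
  defines "m \<equiv> card (verts H) - length vs" and "n \<equiv> card (verts G)"
  shows "rooted_count vs H us G \<le> n ^ m"
    and "\<bar>real (rooted_count vs H us G) - real n ^ m * (p ^ card (edges H) / real (aut_rooted vs H))\<bar>
           \<le> 2 * real m * \<delta> * real n ^ m"
proof -
  let ?T = "verts H - set vs" and ?a = "real (aut_rooted vs H)"
  have fin: "finite (verts H)" using H by (simp add: fin_graph_def)
  have V: "?T \<union> set vs = verts H" using vs by auto
  have H_eq: "Graph (?T \<union> set vs) (edges H) = H" unfolding V by simp
  have cT: "card ?T = m"
    using vs fin by (simp add: card_Diff_subset distinct_card m_def)
  have a: "?a \<ge> 1" using aut_rooted_pos[OF H, of vs] by (simp add: Suc_le_eq)
  have len: "length us = length vs" "distinct us" "set us \<subseteq> verts G"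
    using us by (auto simp: root_tuples_def)
  have emb: "card (embeddings vs H us G) = aut_rooted vs H * rooted_count vs H us G"
    by (rule card_embeddings[OF H G vs(2) len(1)])
  have approx: "card (embeddings vs H us G) \<le> n ^ m"
      "\<bar>real (card (embeddings vs H us G)) - real n ^ m * p ^ card (edges H)\<bar> \<le> 2 * real m * \<delta> * real n ^ m"
    using card_embeddings_approx[OF G reg len(1) vs(1) len(2,3) k p, of ?T "edges H"] fin vs(3) H
    unfolding H_eq V cT n_def by auto
  have "rooted_count vs H us G \<le> aut_rooted vs H * rooted_count vs H us G"
    using aut_rooted_pos[OF H, of vs] by simp
  with approx(1) show "rooted_count vs H us G \<le> n ^ m" unfolding emb by linarith
  have "?a * real (rooted_count vs H us G) - real n ^ m * p ^ card (edges H)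
      = ?a * (real (rooted_count vs H us G) - real n ^ m * (p ^ card (edges H) / ?a))"
    using a by (simp add: field_simps)
  then have "\<bar>?a * real (rooted_count vs H us G) - real n ^ m * p ^ card (edges H)\<bar>
      = ?a * \<bar>real (rooted_count vs H us G) - real n ^ m * (p ^ card (edges H) / ?a)\<bar>"
    using a by (simp add: abs_mult)
  \<comment> \<open>Since \<open>?a \<ge> 1\<close>, passing from embeddings to copies can only
    reduce the error, so the constant is kept.\<close>
  moreover have "\<bar>real (rooted_count vs H us G) - real n ^ m * (p ^ card (edges H) / ?a)\<bar>
      \<le> ?a * \<bar>real (rooted_count vs H us G) - real n ^ m * (p ^ card (edges H) / ?a)\<bar>"
    using mult_right_mono[OF a abs_ge_zero] by simp
  ultimately show "\<bar>real (rooted_count vs H us G) - real n ^ m * (p ^ card (edges H) / real (aut_rooted vs H))\<bar>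
           \<le> 2 * real m * \<delta> * real n ^ m"
    using approx(2) unfolding emb of_nat_mult by linarith
qed

text \<open>Turns the maximum into a single rooted count, at a tuple that may depend on
  \<open>G\<close>. For \<open>length vs \<le> n\<close> the list of the first vertices is
  admissible, so the value is not the unspecified \<open>Max {}\<close>.\<close>

lemma max_rooted_count_attained:
  assumes "length vs \<le> n"
  obtains us where "us \<in> root_tuples n (length vs)"
    "max_rooted_count n vs H G = rooted_count vs H us G"
proof -
  have "root_tuples n (length vs) \<subseteq> {us. set us \<subseteq> {1..n} \<and> length us = length vs}"
    by (auto simp: root_tuples_def)
  then have "finite (root_tuples n (length vs))"
    by (rule finite_subset) (simp add: finite_lists_length_eq)
  moreover have "[1..<Suc (length vs)] \<in> root_tuples n (length vs)"
    using assms by (auto simp: root_tuples_def simp del: upt_Suc)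
  ultimately have "max_rooted_count n vs H G \<in> (\<lambda>us. rooted_count vs H us G) ` root_tuples n (length vs)"
    unfolding max_rooted_count_def by (intro Max_in) auto
  then show thesis using that by auto
qed

lemma max_rooted_count_concentrated:
  fixes p :: real
  assumes p: "0 < p" "p < 1" and H: "fin_graph H"
    and vs: "distinct vs" "set vs \<subseteq> verts H" "\<forall>x\<in>set vs. \<forall>y\<in>set vs. {x, y} \<notin> edges H"
  defines "m \<equiv> card (verts H) - length vs"
  shows "concentrated_around_mean (\<lambda>n. gnp n p) (\<lambda>n G. real (max_rooted_count n vs H G))"
    and "(\<lambda>n. measure_pmf.expectation (gnp n p) (\<lambda>G. real (max_rooted_count n vs H G)) / real n ^ m)
           \<longlonglongrightarrow> p ^ card (edges H) / real (aut_rooted vs H)"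
proof -
  let ?k = "card (verts H)" and ?c = "p ^ card (edges H) / real (aut_rooted vs H)"
  have len: "length vs \<le> ?k"
    using vs H card_mono[of "verts H" "set vs"] by (auto simp: distinct_card fin_graph_def)
  have c: "?c > 0" using p aut_rooted_pos[OF H, of vs] by simp
  have s: "\<forall>\<^sub>F n in sequentially. real n ^ m > 0"
    using eventually_gt_at_top[of 0] by eventually_elim simp
  \<comment> \<open>The trivial regularity with \<open>\<delta> = 1\<close> suffices; it requires
    only \<open>card (verts H) \<le> n\<close>, which also guarantees admissible tuples.\<close>
  have bounded: "\<forall>\<^sub>F n in sequentially. \<forall>G\<in>set_pmf (gnp n p).
      \<bar>real (max_rooted_count n vs H G) / real n ^ m\<bar> \<le> 1"
    using eventually_gt_at_top[of "?k"]
  proof eventually_elim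
    case (elim n)
    show ?case
    proof
      fix G assume "G \<in> set_pmf (gnp n p)"
      note G = gnp_support[OF this]
      obtain us where us: "us \<in> root_tuples n (length vs)"
          "max_rooted_count n vs H G = rooted_count vs H us G"
        using max_rooted_count_attained[of vs n] len elim by (metis le_trans less_imp_le)
      have "rooted_count vs H us G \<le> n ^ m"
        using rooted_count_approx(1)[OF H G(1) _ _ vs _ _ _ extension_regular_1[OF G(1)], of p us]
          p us elim G(2) by (simp add: m_def)
      then have "real (rooted_count vs H us G) \<le> real n ^ m"
        by (metis of_nat_le_iff of_nat_power)
      then show "\<bar>real (max_rooted_count n vs H G) / real n ^ m\<bar> \<le> 1"
        using us elim by simp
    qed
  qed
  have prob: "(\<lambda>n. measure_pmf.prob (gnp n p)
      {G. \<bar>real (max_rooted_count n vs H G) / real n ^ m - ?c\<bar> > \<epsilon>}) \<longlonglongrightarrow> 0"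
    if \<epsilon>: "\<epsilon> > 0" for \<epsilon>
  proof -
    \<comment> \<open>The summand 1 keeps the quotient meaningful when every vertex is a root, that
      is for \<open>m = 0\<close>.\<close>
    define \<delta> where "\<delta> = \<epsilon> / (2 * m + 1)"
    have \<delta>: "\<delta> > 0" "2 * real m * \<delta> \<le> \<epsilon>" using \<epsilon> by (auto simp: \<delta>_def field_simps)
    have "\<forall>\<^sub>F n in sequentially. real ?k \<le> \<delta> * real n" using \<delta>(1) by real_asymp
    then have "\<forall>\<^sub>F n in sequentially. norm (measure_pmf.prob (gnp n p)
        {G. \<bar>real (max_rooted_count n vs H G) / real n ^ m - ?c\<bar> > \<epsilon>})
        \<le> measure_pmf.prob (gnp n p) {G. \<not> extension_regular ?k p \<delta> G}"
      using eventually_gt_at_top[of "?k"]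
    proof eventually_elim
      case (elim n)
      have "\<bar>real (max_rooted_count n vs H G) / real n ^ m - ?c\<bar> \<le> \<epsilon>"
        if "G \<in> set_pmf (gnp n p)" and reg: "extension_regular ?k p \<delta> G" for G
      proof -
        note G = gnp_support[OF that(1)]
        obtain us where us: "us \<in> root_tuples n (length vs)"
            "max_rooted_count n vs H G = rooted_count vs H us G"
          using max_rooted_count_attained[of vs n] len elim by (metis le_trans less_imp_le)
        let ?r = "real (rooted_count vs H us G)"
        have "\<bar>?r - real n ^ m * ?c\<bar> \<le> 2 * real m * \<delta> * real n ^ m"
          using rooted_count_approx(2)[OF H G(1) _ _ vs _ _ _ reg, of us] p us elim G(2)
          by (simp add: m_def)
        also have "\<dots> \<le> \<epsilon> * real n ^ m" using \<delta> by (intro mult_right_mono) auto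
        finally have "\<bar>?r - real n ^ m * ?c\<bar> / real n ^ m \<le> \<epsilon>"
          using elim by (simp add: divide_le_eq)
        moreover have "?r / real n ^ m - ?c = (?r - real n ^ m * ?c) / real n ^ m"
          using elim by (simp add: diff_divide_distrib)
        then have "\<bar>?r / real n ^ m - ?c\<bar> = \<bar>?r - real n ^ m * ?c\<bar> / real n ^ m"
          by (simp only: abs_divide abs_of_nat power_abs)
        ultimately show ?thesis unfolding us(2) by simp
      qed
      then have "AE G in gnp n p. G \<in> {G. \<bar>real (max_rooted_count n vs H G) / real n ^ m - ?c\<bar> > \<epsilon>}
          \<longrightarrow> G \<in> {G. \<not> extension_regular ?k p \<delta> G}"
        by (intro AE_pmfI) (use linorder_not_less in blast)
      then show ?case
        by (simp add: measure_pmf.finite_measure_mono_AE)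
    qed
    then show ?thesis
      by (rule Lim_null_comparison) (use gnp_extension_regular p \<delta>(1) in auto)
  qed
  show "concentrated_around_mean (\<lambda>n. gnp n p) (\<lambda>n G. real (max_rooted_count n vs H G))"
    by (rule concentrated_if_tendsto_in_prob(1)[OF finite_set_pmf_gnp c s bounded prob])
  show "(\<lambda>n. measure_pmf.expectation (gnp n p) (\<lambda>G. real (max_rooted_count n vs H G)) / real n ^ m)
           \<longlonglongrightarrow> ?c"
    by (rule concentrated_if_tendsto_in_prob(2)[OF finite_set_pmf_gnp c s bounded prob])
qed

section \<open>The count without roots and its exact mean\<close>

lemma subgraph_count_conv_rooted_count: "subgraph_count H G = rooted_count [] H [] G"
  by (simp add: subgraph_count_def rooted_count_def)

lemma max_rooted_count_Nil: "max_rooted_count n [] H G = subgraph_count H G"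
proof -
  have "root_tuples n 0 = {[]}" by (auto simp: root_tuples_def)
  then show ?thesis by (simp add: max_rooted_count_def subgraph_count_conv_rooted_count)
qed

text \<open>\<open>aut H\<close> times the number of copies is the number of injections of the
  vertices that carry all edges of \<open>H\<close> into the graph; linearity of expectation applies
  to the sum of their indicators.\<close>

lemma expectation_subgraph_count:
  fixes p :: real
  assumes p: "0 \<le> p" "p \<le> 1" and H: "fin_graph H"
  shows "measure_pmf.expectation (gnp n p) (\<lambda>G. real (subgraph_count H G)) =
           1 / real (aut H) * real (falling_fact n (card (verts H))) * p ^ card (edges H)"
proof -
  define F where "F = {f \<in> verts H \<rightarrow>\<^sub>E {1..n}. inj_on f (verts H)}"
  have finV: "finite (verts H)" using H by (simp add: fin_graph_def)
  have finF: "finite F"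
    by (rule finite_subset[of _ "verts H \<rightarrow>\<^sub>E {1..n}"]) (auto simp: F_def finV intro!: finite_PiE)
  \<comment> \<open>Also valid for \<open>n < card (verts H)\<close>: there are no injections, and
    the truncated product contains a factor 0.\<close>
  have cardF: "card F = falling_fact n (card (verts H))"
    using card_inj_on_subset_funcset[OF finV finite_atLeastAtMost[of 1 n] order_refl]
    by (simp add: F_def falling_fact_def lessThan_atLeast0)
  have prob: "measure_pmf.prob (gnp n p) {G. (`) f ` edges H \<subseteq> edges G} = p ^ card (edges H)"
    if f: "f \<in> F" for f
  proof -
    have inj: "inj_on f (verts H)" using f by (simp add: F_def)
    have eV: "e \<subseteq> verts H" "card e = 2" if "e \<in> edges H" for e
      using that H by (auto simp: fin_graph_def)
    have "inj_on ((`) f) (edges H)"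
      using inj eV by (auto intro!: inj_onI simp: inj_on_image_eq_iff)
    then have "card ((`) f ` edges H) = card (edges H)" by (rule card_image)
    moreover have "f ` e \<in> vertex_pairs n" if "e \<in> edges H" for e
    proof -
      have "card (f ` e) = 2" using inj eV[OF that] by (metis card_image inj_on_subset)
      moreover have "f ` e \<subseteq> {1..n}" using f eV(1)[OF that] by (auto simp: F_def)
      ultimately show ?thesis by (simp add: vertex_pairs_def)
    qed
    ultimately show ?thesis using prob_gnp_edges[of "(`) f ` edges H" n p] p by auto
  qed
  have "real (aut H) * measure_pmf.expectation (gnp n p) (\<lambda>G. real (subgraph_count H G)) =
      measure_pmf.expectation (gnp n p) (\<lambda>G. real (aut H) * subgraph_count H G)"
    by simp
  also have "\<dots> = measure_pmf.expectation (gnp n p)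
      (\<lambda>G. \<Sum>f\<in>F. indicator {G. (`) f ` edges H \<subseteq> edges G} G)"
  proof (intro integral_cong_AE AE_pmfI)
    fix G assume "G \<in> set_pmf (gnp n p)"
    note G = gnp_support[OF this]
    have "aut H * subgraph_count H G = card (embeddings [] H [] G)"
      using card_embeddings[OF H G(1), of "[]" "[]"]
      by (simp add: aut_rooted_Nil subgraph_count_conv_rooted_count)
    also have "embeddings [] H [] G = {f \<in> F. (`) f ` edges H \<subseteq> edges G}"
      using G(2) by (auto simp: embeddings_def F_def)
    finally show "real (aut H) * subgraph_count H G =
        (\<Sum>f\<in>F. indicator {G. (`) f ` edges H \<subseteq> edges G} G)"
      using finF by (simp add: indicator_def Int_def flip: of_nat_mult)
  qed auto
  also have "\<dots> = (\<Sum>f\<in>F. measure_pmf.prob (gnp n p) {G. (`) f ` edges H \<subseteq> edges G})"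
    by (subst Bochner_Integration.integral_sum)
       (auto intro: integrable_measure_pmf_finite finite_set_pmf_gnp)
  also have "\<dots> = real (falling_fact n (card (verts H))) * p ^ card (edges H)"
    by (simp add: prob cardF)
  finally show ?thesis
    using aut_rooted_pos[OF H, of "[]"] by (simp add: aut_rooted_Nil field_simps)
qed

theorem corollary5p7:
  fixes p :: real and H :: "'a graph"
  assumes "0 < p" and "p < 1" and "fin_graph H"
  shows "(concentrated_around_mean (\<lambda>n. gnp n p) (\<lambda>n G. real (subgraph_count H G)) \<and>
          (\<forall>n. measure_pmf.expectation (gnp n p) (\<lambda>G. real (subgraph_count H G)) =
             1 / real (aut H) * real (falling_fact n (card (verts H))) * p ^ card (edges H))) \<and>
         (\<forall>vs. distinct vs \<and> set vs \<subseteq> verts H \<and>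
             (\<forall>x\<in>set vs. \<forall>y\<in>set vs. {x, y} \<notin> edges H) \<longrightarrow>
           concentrated_around_mean (\<lambda>n. gnp n p)
             (\<lambda>n G. real (max_rooted_count n vs H G)) \<and>
           (\<exists>\<epsilon> :: nat \<Rightarrow> real. \<epsilon> \<longlonglongrightarrow> 0 \<and>
             (\<forall>\<^sub>F n in sequentially.
               measure_pmf.expectation (gnp n p) (\<lambda>G. real (max_rooted_count n vs H G)) =
                 (1 / real (aut_rooted vs H) + \<epsilon> n) *
                 real n ^ (card (verts H) - length vs) * p ^ card (edges H))))"
proof (intro conjI allI impI)
  show "concentrated_around_mean (\<lambda>n. gnp n p) (\<lambda>n G. real (subgraph_count H G))"
    using max_rooted_count_concentrated(1)[OF assms, of "[]"] by (simp add: max_rooted_count_Nil)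
next
  fix n
  show "measure_pmf.expectation (gnp n p) (\<lambda>G. real (subgraph_count H G)) =
      1 / real (aut H) * real (falling_fact n (card (verts H))) * p ^ card (edges H)"
    using assms by (intro expectation_subgraph_count) auto
next
  fix vs :: "'a list"
  assume vs: "distinct vs \<and> set vs \<subseteq> verts H \<and> (\<forall>x\<in>set vs. \<forall>y\<in>set vs. {x, y} \<notin> edges H)"
  then show "concentrated_around_mean (\<lambda>n. gnp n p) (\<lambda>n G. real (max_rooted_count n vs H G))"
    using assms by (intro max_rooted_count_concentrated(1)) auto
  let ?s = "\<lambda>n. real n ^ (card (verts H) - length vs)" and ?e = "p ^ card (edges H)"
  let ?E = "\<lambda>n. measure_pmf.expectation (gnp n p) (\<lambda>G. real (max_rooted_count n vs H G))"
  define \<epsilon> where "\<epsilon> = (\<lambda>n. ?E n / ?s n / ?e - 1 / real (aut_rooted vs H))"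
  have "(\<lambda>n. ?E n / ?s n) \<longlonglongrightarrow> ?e / real (aut_rooted vs H)"
    using assms vs by (intro max_rooted_count_concentrated(2)) auto
  then have "(\<lambda>n. ?E n / ?s n / ?e) \<longlonglongrightarrow> ?e / real (aut_rooted vs H) / ?e"
    by (rule tendsto_divide[OF _ tendsto_const]) (use assms in auto)
  then have "\<epsilon> \<longlonglongrightarrow> 0"
    unfolding \<epsilon>_def LIM_zero_iff using assms by simp
  moreover have "\<forall>\<^sub>F n in sequentially. ?E n = (1 / real (aut_rooted vs H) + \<epsilon> n) * ?s n * ?e"
    using eventually_gt_at_top[of 0] by eventually_elim (use assms in \<open>simp add: \<epsilon>_def\<close>)
  ultimately show "\<exists>\<epsilon> :: nat \<Rightarrow> real. \<epsilon> \<longlonglongrightarrow> 0 \<and>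
      (\<forall>\<^sub>F n in sequentially. ?E n = (1 / real (aut_rooted vs H) + \<epsilon> n) * ?s n * ?e)"
    by blast
qed

end
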